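(* Consider the linear system $$\dot v=Jv,\qquad u=Kv,\qquad v(0)=v_0,$$ with $v\in\mathbb{R}^{2r}$, where $J\in\mathbb{R}^{2r\times2r}$ is an invertible skew-adjoint matrix with distinct eigenvalues and $K\in\mathbb{R}^{1\times2r}$ is such that the pair $(J,K)$ is observable. Then there exists $v_0\in\mathbb{R}^{2r}$ such that $u$ is differentially exciting of order $2r-1$ at every time $t$.
   Context: For an integer $m\ge0$ and $v=(v_0,\dots,v_{2m})\in\mathbb{R}^{2m+1}$, $\mathfrak M_m(v)$ is the $(m+1)\times(m+1)$ real Hankel matrix with entries $(\mathfrak M_m(v))_{ij}=v_{i+j-2}$, $1\le i,j\le m+1$. A $C^{2m}$ function $u:\mathbb{R}\to\mathbb{R}$ is differentially exciting of order $m$ at time $t$ if the matrix $\mathfrak M_m(u(t),\dot u(t),\dots,u^{(2m)}(t))$ is invertible. *)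

theory Defs
  imports "HOL-Analysis.Analysis" "Jordan_Normal_Form.Spectral_Radius"
begin

(* The matrix and vector notation is that of Jordan_Normal_Form. *)
no_notation vec_nth (infixl \<open>$\<close> 90)
hide_const (open) Finite_Cartesian_Product.vec Finite_Cartesian_Product.mat

definition hankel_mat :: "nat \<Rightarrow> real vec \<Rightarrow> real mat" where
  "hankel_mat m v = mat (m + 1) (m + 1) (\<lambda>(i, j). v $ (i + j))"

definition times_continuously_differentiable :: "nat \<Rightarrow> (real \<Rightarrow> real) \<Rightarrow> bool" where
  "times_continuously_differentiable k u \<longleftrightarrow>
     (\<forall>j<k. \<forall>t. (deriv ^^ j) u differentiable (at t)) \<and>
     continuous_on UNIV ((deriv ^^ k) u)"

definition differentially_exciting :: "nat \<Rightarrow> (real \<Rightarrow> real) \<Rightarrow> real \<Rightarrow> bool" where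
  "differentially_exciting m u t \<longleftrightarrow>
     times_continuously_differentiable (2 * m) u \<and>
     invertible_mat (hankel_mat m (vec (2 * m + 1) (\<lambda>k. (deriv ^^ k) u t)))"

(* The derivative is taken componentwise because the type of vectors carries no norm:
   it contains vectors of every dimension. *)
definition linear_system_solution :: "real mat \<Rightarrow> real vec \<Rightarrow> (real \<Rightarrow> real vec) \<Rightarrow> bool" where
  "linear_system_solution J v0 v \<longleftrightarrow>
     (\<forall>t. v t \<in> carrier_vec (dim_row J)) \<and> v 0 = v0 \<and>
     (\<forall>t. \<forall>i<dim_row J. ((\<lambda>s. v s $ i) has_real_derivative (J *\<^sub>v v t) $ i) (at t))"

(* K has a single row. *)
definition system_output :: "real mat \<Rightarrow> (real \<Rightarrow> real vec) \<Rightarrow> real \<Rightarrow> real" where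
  "system_output K v t = (K *\<^sub>v v t) $ 0"

(* The output on nonnegative times determines the initial state. *)
definition observable :: "real mat \<Rightarrow> real mat \<Rightarrow> bool" where
  "observable J K \<longleftrightarrow>
     (\<forall>v0 w0 v w. linear_system_solution J v0 v \<longrightarrow> linear_system_solution J w0 w \<longrightarrow>
        (\<forall>t\<ge>0. system_output K v t = system_output K w t) \<longrightarrow> v0 = w0)"

definition skew_adjoint :: "real mat \<Rightarrow> bool" where
  "skew_adjoint J \<longleftrightarrow> transpose_mat J = - J"

(* Eigenvalues are complex and counted with multiplicity in the dimension, so there are
   dim_row J of them and they are pairwise distinct iff the spectrum has that many elements. *)
definition distinct_eigenvalues :: "real mat \<Rightarrow> bool" where
  "distinct_eigenvalues J \<longleftrightarrow> card (spectrum (map_mat complex_of_real J)) = dim_row J"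

end

theory Submission
  imports Defs
begin

text \<open>Take \<open>v\<^sub>0 = K\<^sup>T\<close>. The \<open>k\<close>-th derivative of the output is \<open>K J\<^sup>k v(t)\<close>, so the Hankel matrix
  is the product of the observability matrix with rows \<open>K J\<^sup>i\<close> and the Krylov matrix with columns
  \<open>J\<^sup>j v(t)\<close>. Observability makes the first factor invertible; since \<open>J\<^sup>T = - J\<close>, the Krylov
  matrix of \<open>K\<^sup>T\<close> is its transpose up to column signs, hence also invertible. Because \<open>J\<close> is skew,
  inner products of solutions are constant, so the Gram matrix of the columns \<open>J\<^sup>j v(t)\<close>,
  and with it the absolute value of the Krylov determinant, does not depend on \<open>t\<close>.\<close>

no_notation inner (infix "\<bullet>" 70)

section \<open>Iterates of a matrix on a vector and Krylov matrices\<close>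

abbreviation mat_iter :: "real mat \<Rightarrow> nat \<Rightarrow> real vec \<Rightarrow> real vec" where
  "mat_iter A k \<equiv> ((*\<^sub>v) A) ^^ k"

text \<open>For \<open>J\<^sup>T\<close> and \<open>row K 0\<close> this is the transpose of the
  observability matrix, whose rows are \<open>K J^i\<close>.\<close>

definition krylov_mat :: "real mat \<Rightarrow> real vec \<Rightarrow> real mat" where
  "krylov_mat A b = mat (dim_row A) (dim_row A) (\<lambda>(i, j). mat_iter A j b $ i)"

lemma krylov_mat_carrier [simp]:
  "A \<in> carrier_mat n n \<Longrightarrow> krylov_mat A b \<in> carrier_mat n n"
  by (simp add: krylov_mat_def)

lemma krylov_mat_dim [simp]:
  "dim_row (krylov_mat A b) = dim_row A" "dim_col (krylov_mat A b) = dim_row A"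
  by (simp_all add: krylov_mat_def)

lemma mat_iter_carrier [simp]:
  "A \<in> carrier_mat n n \<Longrightarrow> b \<in> carrier_vec n \<Longrightarrow> mat_iter A k b \<in> carrier_vec n"
  by (induction k) auto

lemma mat_iter_dim [simp]:
  "A \<in> carrier_mat n n \<Longrightarrow> b \<in> carrier_vec n \<Longrightarrow> dim_vec (mat_iter A k b) = n"
  using mat_iter_carrier carrier_vecD by blast

lemma col_krylov_mat:
  assumes "A \<in> carrier_mat n n" "b \<in> carrier_vec n" "j < n"
  shows "col (krylov_mat A b) j = mat_iter A j b"
  using assms by (intro eq_vecI) (auto simp: krylov_mat_def)

lemma row_0_carrier:
  "K \<in> carrier_mat 1 n \<Longrightarrow> row K 0 \<in> carrier_vec n"
  by (auto intro: row_carrier_vec)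

lemma scalar_prod_mult_mat_vec:
  fixes a b :: "real vec"
  assumes "A \<in> carrier_mat n n" "a \<in> carrier_vec n" "b \<in> carrier_vec n"
  shows "a \<bullet> (A *\<^sub>v b) = (A\<^sup>T *\<^sub>v a) \<bullet> b"
  using transpose_vec_mult_scalar[OF assms(1,3,2)] assms
  by (metis comm_scalar_prod mult_mat_vec_carrier transpose_carrier_mat)

lemma scalar_prod_mat_iter:
  assumes "A \<in> carrier_mat n n" "a \<in> carrier_vec n" "b \<in> carrier_vec n"
  shows "a \<bullet> mat_iter A k b = mat_iter (A\<^sup>T) k a \<bullet> b"
  using assms
proof (induction k arbitrary: b)
  case (Suc k)
  have "a \<bullet> mat_iter A (Suc k) b = a \<bullet> mat_iter A k (A *\<^sub>v b)"
    by (simp only: funpow_Suc_right o_apply)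
  also have "\<dots> = mat_iter (A\<^sup>T) k a \<bullet> (A *\<^sub>v b)"
    using Suc by simp
  also have "\<dots> = mat_iter (A\<^sup>T) (Suc k) a \<bullet> b"
    using Suc.prems by (simp add: scalar_prod_mult_mat_vec)
  finally show ?case .
qed simp

lemma scalar_prod_uminus_mat_iter:
  assumes "A \<in> carrier_mat n n" "a \<in> carrier_vec n" "b \<in> carrier_vec n"
  shows "a \<bullet> mat_iter (- A) k b = (- 1) ^ k * (a \<bullet> mat_iter A k b)"
proof -
  have "mat_iter (- A) k b = (- 1) ^ k \<cdot>\<^sub>v mat_iter A k b"
  proof (induction k)
    case 0
    show ?case by simp
  next
    case (Suc k)
    show ?case
      using assms Suc
      by (intro eq_vecI) (auto simp: scalar_prod_def sum_distrib_left sum_negf[symmetric]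
          intro!: sum.cong simp del: sum_negf)
  qed
  then show ?thesis
    using assms by simp
qed

text \<open>A singular Krylov matrix has a left kernel vector \<open>w\<close>; its right kernel expresses some
  \<open>A\<^sup>k b\<close> through lower iterates, which propagates orthogonality to \<open>w\<close> to all iterates
  without appeal to Cayley--Hamilton.\<close>

lemma krylov_mat_singularE:
  assumes A: "A \<in> carrier_mat n n" and b: "b \<in> carrier_vec n"
    and "det (krylov_mat A b) = 0"
  obtains w where "w \<in> carrier_vec n" "w \<noteq> 0\<^sub>v n" "\<And>k. w \<bullet> mat_iter A k b = 0"
proof -
  let ?C = "krylov_mat A b"
  have C: "?C \<in> carrier_mat n n"
    using A by simp
  obtain x where x: "x \<in> carrier_vec n" "x \<noteq> 0\<^sub>v n" "?C *\<^sub>v x = 0\<^sub>v n"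
    using det_0_iff_vec_prod_zero[OF C] assms by auto
  have "det (?C\<^sup>T) = 0"
    using det_transpose[OF C] assms by simp
  then obtain w where w: "w \<in> carrier_vec n" "w \<noteq> 0\<^sub>v n" "?C\<^sup>T *\<^sub>v w = 0\<^sub>v n"
    using det_0_iff_vec_prod_zero[of "?C\<^sup>T" n] C by auto
  have low: "w \<bullet> mat_iter A k b = 0" if "k < n" for k
  proof -
    have "(?C\<^sup>T *\<^sub>v w) $ k = mat_iter A k b \<bullet> w"
      using that A b by (simp add: col_krylov_mat)
    then show ?thesis
      using w that A b by (metis comm_scalar_prod index_zero_vec(1) mat_iter_carrier)
  qed
  \<comment> \<open>The last nonzero coefficient of the kernel vector \<open>x\<close>: dividing by
    it would express \<open>A^d b\<close> through lower iterates.\<close>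
  define d where "d = (GREATEST i. i < n \<and> x $ i \<noteq> 0)"
  have ex: "\<exists>i. i < n \<and> x $ i \<noteq> 0"
    using x by (metis carrier_vecD eq_vecI index_zero_vec)
  then have d: "d < n" "x $ d \<noteq> 0"
    unfolding d_def using GreatestI_ex_nat[OF ex, of n] by auto
  have above: "x $ i = 0" if "d < i" "i < n" for i
    using Greatest_le_nat[of "\<lambda>i. i < n \<and> x $ i \<noteq> 0" i n] that unfolding d_def by force
  \<comment> \<open>The relation between the columns is tested against an arbitrary
    \<open>a\<close>, so that iterates of \<open>A\<^sup>T\<close> on \<open>w\<close> can be
    inserted below.\<close>
  have comb: "(\<Sum>i\<le>d. x $ i * (a \<bullet> mat_iter A i b)) = 0" if a: "a \<in> carrier_vec n" for a
  proof -
    have "0 = a \<bullet> (?C *\<^sub>v x)"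
      using a x by simp
    also have "\<dots> = (?C\<^sup>T *\<^sub>v a) \<bullet> x"
      by (rule scalar_prod_mult_mat_vec[OF C a x(1)])
    also have "\<dots> = (\<Sum>i<n. x $ i * (a \<bullet> mat_iter A i b))"
      using a A b C x
      by (auto simp: scalar_prod_def[of _ x] col_krylov_mat comm_scalar_prod[of a n]
          atLeast0LessThan mult.commute intro!: sum.cong)
    also have "\<dots> = (\<Sum>i\<le>d. x $ i * (a \<bullet> mat_iter A i b))"
      using d above by (intro sum.mono_neutral_right) auto
    finally show ?thesis by simp
  qed
  have "w \<bullet> mat_iter A k b = 0" for k
  proof (induction k rule: less_induct)
    case (less k)
    show ?case
    proof (cases "k < n")
      case False
      define e where "e = k - d"
      have k: "k = e + d"
        using False d by (simp add: e_def)
      \<comment> \<open>Pairing the relation with this vector shifts it by \<open>e\<close>: its top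
        term becomes the one at \<open>k\<close>, and the lower terms vanish by induction.\<close>
      let ?a = "mat_iter (A\<^sup>T) e w"
      have iter: "?a \<bullet> mat_iter A i b = w \<bullet> mat_iter A (e + i) b" for i
        using scalar_prod_mat_iter[of A n w "mat_iter A i b" e] A b w
        by (simp add: funpow_add)
      have "(\<Sum>i\<le>d. x $ i * (w \<bullet> mat_iter A (e + i) b)) = 0"
        using comb[of ?a] A w by (simp add: iter)
      moreover have "(\<Sum>i<d. x $ i * (w \<bullet> mat_iter A (e + i) b)) = 0"
        using less k by (intro sum.neutral) auto
      ultimately have "x $ d * (w \<bullet> mat_iter A k b) = 0"
        by (simp add: k lessThan_Suc_atMost[symmetric])
      then show ?thesis
        using d by simp
    qed (rule low)
  qed
  then show thesis
    using that w by blast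
qed

section \<open>Existence of solutions by power series\<close>

lemma mat_iter_bounded:
  assumes A: "A \<in> carrier_mat n n" and b: "b \<in> carrier_vec n"
  obtains B C where "\<And>k i. i < n \<Longrightarrow> \<bar>mat_iter A k b $ i\<bar> \<le> B * C ^ k"
proof -
  define B where "B = (\<Sum>i<n. \<bar>b $ i\<bar>)"
  \<comment> \<open>The sum over all entries dominates every absolute row sum, so each application
    of \<open>A\<close> enlarges the largest coordinate by at most this factor.\<close>
  define C where "C = (\<Sum>i<n. \<Sum>j<n. \<bar>A $$ (i, j)\<bar>)"
  have "\<bar>mat_iter A k b $ i\<bar> \<le> B * C ^ k" if "i < n" for k i
    using that
  proof (induction k arbitrary: i)
    case 0
    then show ?case
      unfolding B_def by (auto intro!: member_le_sum)
  next
    case (Suc k)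
    have B0: "0 \<le> B" and C0: "0 \<le> C"
      unfolding B_def C_def by (auto intro!: sum_nonneg)
    have row: "(\<Sum>j<n. \<bar>A $$ (i, j)\<bar>) \<le> C"
      unfolding C_def using Suc.prems
      by (intro member_le_sum[of i _ "\<lambda>i. \<Sum>j<n. \<bar>A $$ (i, j)\<bar>"]) (auto intro!: sum_nonneg)
    have "\<bar>mat_iter A (Suc k) b $ i\<bar> = \<bar>\<Sum>j<n. A $$ (i, j) * mat_iter A k b $ j\<bar>"
      using A b Suc.prems by (simp add: scalar_prod_def atLeast0LessThan)
    also have "\<dots> \<le> (\<Sum>j<n. \<bar>A $$ (i, j)\<bar> * (B * C ^ k))"
      by (rule order_trans[OF sum_abs]) (auto simp: abs_mult intro!: sum_mono mult_left_mono Suc.IH)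
    also have "\<dots> = (\<Sum>j<n. \<bar>A $$ (i, j)\<bar>) * (B * C ^ k)"
      by (simp add: sum_distrib_right)
    also have "\<dots> \<le> C * (B * C ^ k)"
      using row B0 C0 by (intro mult_right_mono) auto
    finally show ?case
      by (simp add: mult_ac)
  qed
  then show thesis
    using that by blast
qed

text \<open>The geometric bound on the iterates gives domination by the series of
  \<open>B * exp (C * |t|)\<close>.\<close>

lemma summable_mat_iter_series:
  assumes A: "A \<in> carrier_mat n n" and b: "b \<in> carrier_vec n" and i: "i < n"
  shows "summable (\<lambda>k. mat_iter A k b $ i / fact k * t ^ k)"
proof -
  obtain B C where BC: "\<And>k i. i < n \<Longrightarrow> \<bar>mat_iter A k b $ i\<bar> \<le> B * C ^ k"
    by (rule mat_iter_bounded[OF A b]) blast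
  have "summable (\<lambda>k. B * (inverse (fact k) * (C * \<bar>t\<bar>) ^ k))"
    by (intro summable_mult summable_exp)
  then show ?thesis
  proof (rule summable_comparison_test'[where N = 0])
    fix k
    have "norm (mat_iter A k b $ i / fact k * t ^ k)
        = \<bar>mat_iter A k b $ i\<bar> * (inverse (fact k) * \<bar>t\<bar> ^ k)"
      by (simp add: abs_mult power_abs divide_inverse)
    also have "\<dots> \<le> (B * C ^ k) * (inverse (fact k) * \<bar>t\<bar> ^ k)"
      by (intro mult_right_mono BC i) auto
    finally show "norm (mat_iter A k b $ i / fact k * t ^ k)
        \<le> B * (inverse (fact k) * (C * \<bar>t\<bar>) ^ k)"
      by (simp add: power_mult_distrib mult_ac)
  qed
qed

text \<open>This is \<open>exp (t A) b\<close>, written coordinatewise so that the theory of real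
  power series applies.\<close>

definition linear_flow :: "real mat \<Rightarrow> real vec \<Rightarrow> real \<Rightarrow> real vec" where
  "linear_flow A b t = vec (dim_row A) (\<lambda>i. \<Sum>k. mat_iter A k b $ i / fact k * t ^ k)"

text \<open>A finite sum commutes with convergent series. With \<open>a\<close> a row of
  \<open>A\<close> this identifies the derivative of the flow; with \<open>a\<close> the row of
  \<open>K\<close> it expands the output.\<close>

lemma scalar_prod_linear_flow:
  assumes A: "A \<in> carrier_mat n n" and b: "b \<in> carrier_vec n" and a: "a \<in> carrier_vec n"
  shows "a \<bullet> linear_flow A b t = (\<Sum>k. (a \<bullet> mat_iter A k b) / fact k * t ^ k)"
proof -
  have "a \<bullet> linear_flow A b t = (\<Sum>i<n. \<Sum>k. a $ i * (mat_iter A k b $ i / fact k * t ^ k))"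
    using A b by (simp add: scalar_prod_def linear_flow_def atLeast0LessThan suminf_mult
        summable_mat_iter_series del: times_divide_eq_left times_divide_eq_right)
  also have "\<dots> = (\<Sum>k. \<Sum>i<n. a $ i * (mat_iter A k b $ i / fact k * t ^ k))"
    by (intro suminf_sum[symmetric] summable_mult summable_mat_iter_series[OF A b]) simp
  also have "\<dots> = (\<Sum>k. (a \<bullet> mat_iter A k b) / fact k * t ^ k)"
    using A b by (simp add: scalar_prod_def atLeast0LessThan sum_divide_distrib
        sum_distrib_left sum_distrib_right mult_ac)
  finally show ?thesis .
qed

lemma linear_flow_solution:
  assumes A: "A \<in> carrier_mat n n" and b: "b \<in> carrier_vec n"
  shows "linear_system_solution A b (linear_flow A b)"
  unfolding linear_system_solution_def
proof (intro conjI allI impI)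
  show "linear_flow A b t \<in> carrier_vec (dim_row A)" for t
    by (simp add: linear_flow_def)
  show "linear_flow A b 0 = b"
    using A b by (intro eq_vecI)
      (auto simp: linear_flow_def powser_zero simp del: times_divide_eq_left times_divide_eq_right)
  fix t i
  assume "i < dim_row A"
  then have i: "i < n"
    using A by simp
  let ?c = "\<lambda>k. mat_iter A k b $ i / fact k"
  have "((\<lambda>t. \<Sum>k. ?c k * t ^ k) has_real_derivative (\<Sum>k. diffs ?c k * t ^ k)) (at t)"
    using A b i by (intro termdiffs_strong_converges_everywhere summable_mat_iter_series)
  \<comment> \<open>Termwise differentiation cancels one factor of the factorial and leaves the
    iterate of order \<open>k + 1\<close>, whose last application of \<open>A\<close> is the product
    with \<open>row A i\<close>.\<close>
  moreover have "diffs ?c k = (row A i \<bullet> mat_iter A k b) / fact k" for k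
    using A b i by (simp add: diffs_def field_simps del: of_nat_Suc)
  ultimately show "((\<lambda>s. linear_flow A b s $ i) has_real_derivative
      (A *\<^sub>v linear_flow A b t) $ i) (at t)"
    using A b i scalar_prod_linear_flow[OF A b, of "row A i" t]
    by (simp add: linear_flow_def[of A b "_ :: real"])
qed

section \<open>Solutions, their iterates and the invariants of a skew-adjoint system\<close>

lemma linear_system_solution_carrier:
  "linear_system_solution A b v \<Longrightarrow> A \<in> carrier_mat n n \<Longrightarrow> v t \<in> carrier_vec n"
  by (simp add: linear_system_solution_def)

lemma linear_system_solution_scalar_prod_derivative:
  assumes "linear_system_solution A b v" "A \<in> carrier_mat n n" "a \<in> carrier_vec n"
  shows "((\<lambda>s. a \<bullet> v s) has_real_derivative a \<bullet> (A *\<^sub>v v t)) (at t)"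
proof -
  have v: "v s \<in> carrier_vec n" for s
    using assms linear_system_solution_carrier by blast
  have "((\<lambda>s. \<Sum>i<n. a $ i * v s $ i) has_real_derivative
      (\<Sum>i<n. a $ i * (A *\<^sub>v v t) $ i)) (at t)"
    using assms by (intro DERIV_sum DERIV_cmult) (auto simp: linear_system_solution_def)
  moreover have "a \<bullet> v s = (\<Sum>i<n. a $ i * v s $ i)" for s
    using v[of s] by (simp add: scalar_prod_def atLeast0LessThan)
  moreover have "a \<bullet> (A *\<^sub>v v t) = (\<Sum>i<n. a $ i * (A *\<^sub>v v t) $ i)"
    using assms(2) by (simp add: scalar_prod_def atLeast0LessThan)
  ultimately show ?thesis
    by simp
qed

lemma linear_system_solution_mult:
  assumes "linear_system_solution A b v" "A \<in> carrier_mat n n"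
  shows "linear_system_solution A (A *\<^sub>v b) (\<lambda>t. A *\<^sub>v v t)"
  unfolding linear_system_solution_def
proof (intro conjI allI impI)
  show "A *\<^sub>v v 0 = A *\<^sub>v b"
    using assms by (simp add: linear_system_solution_def)
  fix t i
  assume "i < dim_row A"
  then show "((\<lambda>s. (A *\<^sub>v v s) $ i) has_real_derivative (A *\<^sub>v (A *\<^sub>v v t)) $ i) (at t)"
    using linear_system_solution_scalar_prod_derivative[OF assms, of "row A i" t] assms(2) by simp
qed (use assms linear_system_solution_carrier[OF assms] in auto)

lemma linear_system_solution_mat_iter:
  assumes "linear_system_solution A b v" "A \<in> carrier_mat n n"
  shows "linear_system_solution A (mat_iter A k b) (\<lambda>t. mat_iter A k (v t))"
  using assms by (induction k) (auto dest: linear_system_solution_mult)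

text \<open>The two terms of the product rule cancel by skewness. Two different solutions are
  allowed because a Gram matrix pairs different iterates.\<close>

lemma skew_adjoint_scalar_prod_constant:
  assumes A: "A \<in> carrier_mat n n" "skew_adjoint A"
    and y: "linear_system_solution A a y" and z: "linear_system_solution A b z"
  shows "y t \<bullet> z t = a \<bullet> b"
proof -
  have yc: "y s \<in> carrier_vec n" and zc: "z s \<in> carrier_vec n" for s
    using A y z linear_system_solution_carrier by blast+
  have "((\<lambda>s. y s \<bullet> z s) has_real_derivative 0) (at s)" for s
  proof -
    have "((\<lambda>s. \<Sum>i<n. y s $ i * z s $ i) has_real_derivative
      (\<Sum>i<n. (A *\<^sub>v y s) $ i * z s $ i + (A *\<^sub>v z s) $ i * y s $ i)) (at s)"
      using A y z by (intro DERIV_sum DERIV_mult) (auto simp: linear_system_solution_def)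
    moreover have "(\<lambda>s. y s \<bullet> z s) = (\<lambda>s. \<Sum>i<n. y s $ i * z s $ i)"
      using carrier_vecD[OF zc] by (simp add: scalar_prod_def atLeast0LessThan)
    moreover have "(\<Sum>i<n. (A *\<^sub>v y s) $ i * z s $ i + (A *\<^sub>v z s) $ i * y s $ i)
        = (A *\<^sub>v y s) \<bullet> z s + (A *\<^sub>v z s) \<bullet> y s"
      using zc[of s] yc[of s] by (simp add: scalar_prod_def[of _ "y s"] scalar_prod_def[of _ "z s"]
          atLeast0LessThan sum.distrib del: index_mult_mat_vec)
    moreover have "(A *\<^sub>v z s) \<bullet> y s = - ((A *\<^sub>v y s) \<bullet> z s)"
    proof -
      have "(A *\<^sub>v z s) \<bullet> y s = y s \<bullet> (A *\<^sub>v z s)"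
        using A yc zc by (intro comm_scalar_prod) auto
      also have "\<dots> = ((- A) *\<^sub>v y s) \<bullet> z s"
        using A scalar_prod_mult_mat_vec[OF A(1) yc zc] by (simp add: skew_adjoint_def)
      also have "\<dots> = - ((A *\<^sub>v y s) \<bullet> z s)"
        using A yc[of s] zc[of s] by (simp add: uminus_mult_mat_vec)
      finally show ?thesis .
    qed
    ultimately show ?thesis
      by simp
  qed
  then have "y t \<bullet> z t = y 0 \<bullet> z 0"
    using DERIV_isconst_all by blast
  then show ?thesis
    using y z by (simp add: linear_system_solution_def)
qed

text \<open>Allowing two matrices covers both the Gram matrix of one Krylov family and the
  factorization of the Hankel matrix through \<open>J\<^sup>T\<close> and \<open>J\<close>.\<close>

lemma krylov_mat_transpose_mult:
  assumes "A \<in> carrier_mat n n" "B \<in> carrier_mat n n" "a \<in> carrier_vec n" "b \<in> carrier_vec n"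
  shows "(krylov_mat A a)\<^sup>T * krylov_mat B b
    = mat n n (\<lambda>(i, j). mat_iter A i a \<bullet> mat_iter B j b)"
  using assms
  by (intro eq_matI) (auto simp: col_krylov_mat)

lemma det_krylov_mat_transpose_mult:
  assumes "A \<in> carrier_mat n n" "B \<in> carrier_mat n n"
  shows "det ((krylov_mat A a)\<^sup>T * krylov_mat B b) = det (krylov_mat A a) * det (krylov_mat B b)"
  using assms det_mult[of "(krylov_mat A a)\<^sup>T" n "krylov_mat B b"]
    det_transpose[of "krylov_mat A a" n] by simp

lemma det_krylov_mat_solution_nonzero:
  assumes A: "A \<in> carrier_mat n n" "skew_adjoint A" and b: "b \<in> carrier_vec n"
    and v: "linear_system_solution A b v"
    and "det (krylov_mat A b) \<noteq> 0"
  shows "det (krylov_mat A (v t)) \<noteq> 0"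
proof -
  have "mat_iter A i (v t) \<bullet> mat_iter A j (v t) = mat_iter A i b \<bullet> mat_iter A j b" for i j
    using linear_system_solution_mat_iter[OF v A(1)]
    by (intro skew_adjoint_scalar_prod_constant[OF A])
  then have "(krylov_mat A (v t))\<^sup>T * krylov_mat A (v t) = (krylov_mat A b)\<^sup>T * krylov_mat A b"
    using A b linear_system_solution_carrier[OF v A(1)] by (simp add: krylov_mat_transpose_mult)
  then have "det (krylov_mat A (v t)) * det (krylov_mat A (v t))
      = det (krylov_mat A b) * det (krylov_mat A b)"
    using A by (metis det_krylov_mat_transpose_mult)
  then show ?thesis
    using assms by auto
qed

section \<open>Observability and derivatives of the output\<close>

text \<open>All power series coefficients of the output started at \<open>w\<close> vanish, so it
  agrees with the output of the zero solution, and observability identifies the two initial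
  states.\<close>

lemma observable_orthogonal_imp_zero:
  assumes J: "J \<in> carrier_mat n n" and K: "K \<in> carrier_mat 1 n" and obs: "observable J K"
    and w: "w \<in> carrier_vec n" and orth: "\<And>k. row K 0 \<bullet> mat_iter J k w = 0"
  shows "w = 0\<^sub>v n"
proof -
  have "linear_system_solution J (0\<^sub>v n) (\<lambda>_. 0\<^sub>v n)"
    using J by (auto simp: linear_system_solution_def)
  moreover have "system_output K (linear_flow J w) t = system_output K (\<lambda>_. 0\<^sub>v n) t" for t
    using K orth row_0_carrier[OF K]
      scalar_prod_linear_flow[OF J w row_0_carrier[OF K], of t]
    by (simp add: system_output_def)
  ultimately show ?thesis
    using obs linear_flow_solution[OF J w] unfolding observable_def by blast
qed

lemma system_output_derivative:
  assumes J: "J \<in> carrier_mat n n" and K: "K \<in> carrier_mat 1 n"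
    and v: "linear_system_solution J v0 v"
  shows "(system_output K (\<lambda>s. mat_iter J k (v s)) has_real_derivative
    system_output K (\<lambda>s. mat_iter J (Suc k) (v s)) t) (at t)"
  using linear_system_solution_scalar_prod_derivative[
      OF linear_system_solution_mat_iter[OF v J] J row_0_carrier[OF K], of k t] K
  by (simp add: system_output_def[abs_def])

lemma deriv_funpow_system_output:
  assumes "J \<in> carrier_mat n n" "K \<in> carrier_mat 1 n" "linear_system_solution J v0 v"
  shows "(deriv ^^ k) (system_output K v) = system_output K (\<lambda>s. mat_iter J k (v s))"
proof (induction k)
  case (Suc k)
  then show ?case
    using DERIV_imp_deriv[OF system_output_derivative[OF assms]] by auto
qed simp

lemma times_continuously_differentiable_system_output:
  assumes "J \<in> carrier_mat n n" "K \<in> carrier_mat 1 n" "linear_system_solution J v0 v"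
  shows "times_continuously_differentiable k (system_output K v)"
  unfolding times_continuously_differentiable_def deriv_funpow_system_output[OF assms]
  using system_output_derivative[OF assms]
  by (meson DERIV_continuous_on has_field_derivative_at_within real_differentiable_def)

text \<open>The derivative of order \<open>i + j\<close> is \<open>K J^(i+j) v(t)\<close>; moving
  \<open>i\<close> factors onto \<open>K\<close> by transposition separates the two indices.\<close>

lemma hankel_mat_system_output:
  assumes J: "J \<in> carrier_mat (Suc m) (Suc m)" and K: "K \<in> carrier_mat 1 (Suc m)"
    and v: "linear_system_solution J v0 v"
  shows "hankel_mat m (vec (2 * m + 1) (\<lambda>k. (deriv ^^ k) (system_output K v) t))
    = (krylov_mat (J\<^sup>T) (row K 0))\<^sup>T * krylov_mat J (v t)"
proof -
  have vt: "v t \<in> carrier_vec (Suc m)"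
    using v J linear_system_solution_carrier by blast
  have "(deriv ^^ (i + j)) (system_output K v) t
      = mat_iter (J\<^sup>T) i (row K 0) \<bullet> mat_iter J j (v t)" for i j
  proof -
    have "(deriv ^^ (i + j)) (system_output K v) t = row K 0 \<bullet> mat_iter J (i + j) (v t)"
      unfolding deriv_funpow_system_output[OF J K v] using K by (simp add: system_output_def)
    then show ?thesis
      using scalar_prod_mat_iter[OF J row_0_carrier[OF K]
          mat_iter_carrier[OF J vt]]
      by (simp add: funpow_add)
  qed
  then show ?thesis
    using J vt row_0_carrier[OF K] by (subst krylov_mat_transpose_mult[where n = "Suc m"])
      (auto simp: hankel_mat_def intro!: eq_matI)
qed

lemma invertible_mat_if_det_nonzero:
  fixes A :: "'a :: field mat"
  assumes "A \<in> carrier_mat n n" "det A \<noteq> 0"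
  shows "invertible_mat A"
  using det_non_zero_imp_unit[OF assms, of "()"] assms(1)
  unfolding Units_def ring_mat_def invertible_mat_def inverts_mat_def by auto

theorem lemma1:
  fixes r :: nat and J K :: "real mat"
  assumes "r \<ge> 1"
    and "J \<in> carrier_mat (2 * r) (2 * r)"
    and "K \<in> carrier_mat 1 (2 * r)"
    and "invertible_mat J"
    and "skew_adjoint J"
    and "distinct_eigenvalues J"
    and "observable J K"
  shows "\<exists>v0 \<in> carrier_vec (2 * r).
           (\<exists>v. linear_system_solution J v0 v) \<and>
           (\<forall>v. linear_system_solution J v0 v \<longrightarrow>
              (\<forall>t. differentially_exciting (2 * r - 1) (system_output K v) t))"
proof (rule bexI[of _ "row K 0"], intro conjI exI allI impI)
  let ?n = "2 * r" and ?b = "row K 0"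
  note J = assms(2) and K = assms(3)
  show b: "?b \<in> carrier_vec ?n"
    using K by (rule row_0_carrier)
  show "linear_system_solution J ?b (linear_flow J ?b)"
    using J b by (rule linear_flow_solution)
  have sign: "w \<bullet> mat_iter (J\<^sup>T) k ?b = (- 1) ^ k * (w \<bullet> mat_iter J k ?b)"
    if "w \<in> carrier_vec ?n" for w k
    using scalar_prod_uminus_mat_iter[OF J that b] assms(5) by (simp add: skew_adjoint_def)
  have adj: "?b \<bullet> mat_iter J k w = w \<bullet> mat_iter (J\<^sup>T) k ?b"
    if "w \<in> carrier_vec ?n" for w k
    using scalar_prod_mat_iter[OF J b that, of k] J b that
    by (metis comm_scalar_prod mat_iter_carrier transpose_carrier_mat)
  have JT: "J\<^sup>T \<in> carrier_mat ?n ?n"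
    using J by simp
  \<comment> \<open>A singular matrix would yield a nonzero \<open>w\<close> with
    \<open>K J^k w = 0\<close> for all \<open>k\<close>, against observability.\<close>
  have O: "det (krylov_mat (J\<^sup>T) ?b) \<noteq> 0"
    using krylov_mat_singularE[OF JT b] observable_orthogonal_imp_zero[OF J K assms(7)] adj
    by metis
  \<comment> \<open>The same contradiction: up to the sign \<open>(- 1) ^ k\<close>, orthogonality
    to the iterates of \<open>J\<close> is orthogonality to those of
    \<open>J\<^sup>T\<close>.\<close>
  have C: "det (krylov_mat J ?b) \<noteq> 0"
    using krylov_mat_singularE[OF J b] observable_orthogonal_imp_zero[OF J K assms(7)] adj sign
    by (metis mult_zero_right)
  fix v t
  assume v: "linear_system_solution J ?b v"
  \<comment> \<open>Order \<open>2 * r - 1\<close> means size \<open>2 * r\<close>; as the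
    subtraction is truncated, this uses \<open>r \<ge> 1\<close>.\<close>
  have n: "?n = Suc (?n - 1)"
    using assms(1) by simp
  let ?H = "hankel_mat (?n - 1) (vec (2 * (?n - 1) + 1) (\<lambda>k. (deriv ^^ k) (system_output K v) t))"
  have "?H = (krylov_mat (J\<^sup>T) ?b)\<^sup>T * krylov_mat J (v t)"
    using hankel_mat_system_output[of J "?n - 1" K] J K v n by metis
  then have "det ?H = det (krylov_mat (J\<^sup>T) ?b) * det (krylov_mat J (v t))"
    using det_krylov_mat_transpose_mult[OF JT J] by metis
  also have "\<dots> \<noteq> 0"
    using O det_krylov_mat_solution_nonzero[OF J assms(5) b v C] by simp
  finally have "invertible_mat ?H"
    by (rule invertible_mat_if_det_nonzero[where n = "Suc (?n - 1)", rotated])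
      (simp add: hankel_mat_def)
  then show "differentially_exciting (?n - 1) (system_output K v) t"
    unfolding differentially_exciting_def
    using times_continuously_differentiable_system_output[OF J K v] by blast
qed

end
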